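(* Let $n=3$, $\pmb\lambda=(5,3,1)$ and $\pmb\mu=(3,0,0)$, and let $$W=\{\mathbf{w}\in\mathbb{N}^3: K_{\pmb\lambda/\pmb\mu,\mathbf{w}}>0\ \text{ and }\ \overline{\mathbf{w}}\unrhd\overline{\pmb\lambda-\pmb\mu}\}.$$ Let $\pmb\kappa,\pmb\nu$ be partitions of length at most $3$ such that $\pmb\kappa+k\pmb\lambda\supseteq\pmb\nu+k\pmb\mu$ for some positive integer $k$. Then for all sufficiently large $r$ the polynomial $$\prod_{\mathbf{w}\in W}\left(X-\mathbf{x}^{\mathbf{w}}\right)$$ is not the minimal polynomial of the sequence $\{s_{\pmb\kappa+l\pmb\lambda/\pmb\nu+l\pmb\mu}(\mathbf{x})\}_{l=r}^{\infty}$ of skew Schur polynomials in three variables $\mathbf{x}=(x_1,x_2,x_3)$.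
   Context: $\mathbb{N}$ includes $0$. A partition is a vector $\pmb\lambda=(\lambda_1\geq\cdots\geq\lambda_n)$ of nonnegative integers; its length is the number of strictly positive entries; partitions of length at most $n$ are regarded as vectors in $\mathbb{Z}^n$, added and scaled coordinatewise. $\pmb\lambda\supseteq\pmb\mu$ means $\mu_i\leq\lambda_i$ for all $i$. The domination order: $\pmb\lambda\unrhd\pmb\mu$ means $\sum_{i=1}^n\lambda_i=\sum_{i=1}^n\mu_i$ and $\sum_{i=1}^k\lambda_i\geq\sum_{i=1}^k\mu_i$ for all $k$. For a vector $\mathbf{w}$, $\overline{\mathbf{w}}$ is obtained from $\mathbf{w}$ by rearranging its coordinates in non-increasing order. For $\pmb\lambda\supseteq\pmb\mu$, the skew Young diagram of shape $\pmb\lambda/\pmb\mu$ has one box in row $i$, column $j$ for each $(i,j)$ with $\mu_i<j\leq\lambda_i$. A semi-standard Young tableau of this shape is a filling of the boxes with positive integers, strictly increasing down each column and weakly increasing along each row from left to right. $\mathbb{T}^n_{\pmb\lambda/\pmb\mu}$ is the set of those with entries in $[n]=\{1,\ldots,n\}$. The weight $w(T)=(t_1,\ldots,t_n)$ of $T\in\mathbb{T}^n_{\pmb\lambda/\pmb\mu}$ has $t_i$ equal to the number of boxes filled with $i$. The Kostka coefficient $K_{\pmb\lambda/\pmb\mu,\mathbf{w}}$ is the number of tableaux of shape $\pmb\lambda/\pmb\mu$ with weight $\mathbf{w}$. The skew Schur polynomial is $s_{\pmb\lambda/\pmb\mu}(\mathbf{x})=\sum_{T\in\mathbb{T}^n_{\pmb\lambda/\pmb\mu}}\mathbf{x}^{w(T)}$,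 where $\mathbf{x}^{\mathbf{m}}=x_1^{m_1}\cdots x_n^{m_n}$. A sequence $\{a_l\}_{l\geq r}$ in $\mathbb{C}(x_1,\ldots,x_n)$ satisfies a linear recursion of order $d\geq1$ if there are $c_1,\ldots,c_d\in\mathbb{C}(x_1,\ldots,x_n)$, $c_d\neq0$, with $a_l=\sum_{j=1}^dc_ja_{l-j}$ for all $l\geq r+d$; its characteristic polynomial is $X^d-\sum_{j=1}^dc_jX^{d-j}$. The minimal polynomial of the sequence is the characteristic polynomial (of a linear recursion satisfied by the sequence) that divides the characteristic polynomial of every linear recursion satisfied by the sequence. *)

theory Defs
  imports "HOL-Computational_Algebra.Computational_Algebra" "HOL-Library.FuncSet"
begin

(* Vectors in N^n are lists of length n.  Rows of diagrams are numbered from 0, like list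
   positions; columns and tableau entries are numbered from 1. *)

definition is_partition :: "nat \<Rightarrow> nat list \<Rightarrow> bool" where
  "is_partition n lam \<longleftrightarrow> length lam = n \<and> sorted_wrt (\<ge>) lam"

definition vadd :: "nat list \<Rightarrow> nat list \<Rightarrow> nat list" where
  "vadd u v = map2 (+) u v"

(* Truncated subtraction, hence meaningful only when u contains v. *)
definition vsub :: "nat list \<Rightarrow> nat list \<Rightarrow> nat list" where
  "vsub u v = map2 (-) u v"

definition vscale :: "nat \<Rightarrow> nat list \<Rightarrow> nat list" where
  "vscale k v = map ((*) k) v"

definition contains :: "nat list \<Rightarrow> nat list \<Rightarrow> bool" where
  "contains lam mu \<longleftrightarrow> list_all2 (\<ge>) lam mu"

definition dominates :: "nat list \<Rightarrow> nat list \<Rightarrow> bool" where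
  "dominates lam mu \<longleftrightarrow> sum_list lam = sum_list mu \<and>
     (\<forall>k \<le> length lam. sum_list (take k lam) \<ge> sum_list (take k mu))"

definition rearrange :: "nat list \<Rightarrow> nat list" where
  "rearrange w = rev (sort w)"

definition skew_diagram :: "nat list \<Rightarrow> nat list \<Rightarrow> (nat \<times> nat) set" where
  "skew_diagram lam mu = {(i, j). i < length lam \<and> mu ! i < j \<and> j \<le> lam ! i}"

(* Extensional functions, so that each filling of the boxes is represented exactly once. *)
definition ssyt :: "nat \<Rightarrow> nat list \<Rightarrow> nat list \<Rightarrow> (nat \<times> nat \<Rightarrow> nat) set" where
  "ssyt n lam mu = {T \<in> skew_diagram lam mu \<rightarrow>\<^sub>E {1..n}.
     (\<forall>i i' j. (i, j) \<in> skew_diagram lam mu \<and> (i', j) \<in> skew_diagram lam mu \<and> i < i'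
        \<longrightarrow> T (i, j) < T (i', j)) \<and>
     (\<forall>i j j'. (i, j) \<in> skew_diagram lam mu \<and> (i, j') \<in> skew_diagram lam mu \<and> j < j'
        \<longrightarrow> T (i, j) \<le> T (i, j'))}"

definition weight :: "nat \<Rightarrow> nat list \<Rightarrow> nat list \<Rightarrow> (nat \<times> nat \<Rightarrow> nat) \<Rightarrow> nat list" where
  "weight n lam mu T = map (\<lambda>m. card {b \<in> skew_diagram lam mu. T b = m}) [1..<Suc n]"

definition kostka :: "nat list \<Rightarrow> nat list \<Rightarrow> nat list \<Rightarrow> nat" where
  "kostka lam mu w = card {T \<in> ssyt (length w) lam mu. weight (length w) lam mu T = w}"

definition monomial :: "'a::comm_semiring_1 list \<Rightarrow> nat list \<Rightarrow> 'a" where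
  "monomial x m = (\<Prod>i<length x. (x ! i) ^ (m ! i))"

(* The number n of variables is the length of x. *)
definition skew_schur :: "nat list \<Rightarrow> nat list \<Rightarrow> 'a::comm_semiring_1 list \<Rightarrow> 'a" where
  "skew_schur lam mu x =
     (\<Sum>T\<in>ssyt (length x) lam mu. monomial x (weight (length x) lam mu T))"

definition satisfies_recursion ::
    "(nat \<Rightarrow> 'a::field) \<Rightarrow> nat \<Rightarrow> nat \<Rightarrow> (nat \<Rightarrow> 'a) \<Rightarrow> bool" where
  "satisfies_recursion a r d c \<longleftrightarrow> d \<ge> 1 \<and> c d \<noteq> 0 \<and>
     (\<forall>l \<ge> r + d. a l = (\<Sum>j=1..d. c j * a (l - j)))"

definition recursion_poly :: "nat \<Rightarrow> (nat \<Rightarrow> 'a::field) \<Rightarrow> 'a poly" where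
  "recursion_poly d c = monom 1 d - (\<Sum>j=1..d. monom (c j) (d - j))"

(* The sequence is a restricted to the indices l \<ge> r. *)
definition is_minimal_poly :: "(nat \<Rightarrow> 'a::field) \<Rightarrow> nat \<Rightarrow> 'a poly \<Rightarrow> bool" where
  "is_minimal_poly a r p \<longleftrightarrow>
     (\<exists>d c. satisfies_recursion a r d c \<and> p = recursion_poly d c) \<and>
     (\<forall>d c. satisfies_recursion a r d c \<longrightarrow> p dvd recursion_poly d c)"

(* C(x1,x2,x3) as the fraction field of C[x1][x2][x3]. *)
type_synonym ratfun3 = "complex poly poly poly fract"

definition vars3 :: "ratfun3 list" where
  "vars3 = [Fract [:[:[:0, 1:]:]:] 1, Fract [:[:0, 1:]:] 1, Fract [:0, 1:] 1]"

end

(* A tableau with entries in {1, 2, 3} is a chain mu <= a <= b <= lam of interlacing partitions,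
   where a and b are cut out by the entries <= 1 and <= 2.  So the l-th skew Schur polynomial is,
   up to a factor c (x3^9 / x1^3)^l, the sum of p^|a| q^|b| over such chains, where p = x1 / x2 and
   q = x2 / x3.  The ranges of a and b have end points linear in l, and evaluating the nested
   geometric sums expresses the sequence as a linear combination of exponentials in l.  Of their
   bases only the power of p matters: the top row contributes p^3 or p^5, the two lower rows
   contribute 1, p or p^3.  Hence every root of the minimal polynomial is x1^(-3) x3^9 p^i q^j with
   i in {3, 4, 5, 6, 8}, so its degree in x1 is never 4, whereas (4, 2, 0) lies in W. *)

theory Submission
  imports Defs
begin

section \<open>Tableaux as chains of interlacing partitions\<close>

lemma less_3_cases: "i < 3 \<Longrightarrow> i = 0 \<or> i = 1 \<or> i = (2::nat)"
  by linarith

text \<open>Applied to a row of a tableau, this recovers the set of boxes with entries at most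
  \<open>k\<close> from its cardinality alone.\<close>

lemma initial_segment:
  fixes J :: "nat set"
  assumes "J \<subseteq> {m<..l}" and "\<And>i j. j \<in> J \<Longrightarrow> m < i \<Longrightarrow> i \<le> j \<Longrightarrow> i \<in> J"
  shows "J = {m<..m + card J}"
proof (cases "J = {}")
  case False
  have fin: "finite J"
    using assms(1) by (rule finite_subset) simp
  have Max: "Max J \<in> J" using fin False by simp
  have "J = {m<..Max J}"
  proof (intro equalityI subsetI)
    fix i assume "i \<in> J"
    then show "i \<in> {m<..Max J}" using assms(1) fin by auto
  next
    fix i assume "i \<in> {m<..Max J}"
    then show "i \<in> J" using assms(2)[OF Max] by auto
  qed
  moreover from this have "card J = Max J - m" by (metis card_greaterThanAtMost)
  moreover have "m < Max J" using Max assms(1) by auto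
  ultimately show ?thesis by simp
qed simp

text \<open>The last column of row \<open>i\<close> of the partition obtained from \<open>mu\<close> by adding the boxes with
  entries at most \<open>k\<close>.\<close>
definition row_cut :: "nat list \<Rightarrow> nat list \<Rightarrow> (nat \<times> nat \<Rightarrow> nat) \<Rightarrow> nat \<Rightarrow> nat \<Rightarrow> nat" where
  "row_cut lam mu T k i = mu ! i + card {j. (i, j) \<in> skew_diagram lam mu \<and> T (i, j) \<le> k}"

lemma ssyt_entry:
  assumes "T \<in> ssyt n lam mu" "b \<in> skew_diagram lam mu"
  shows "1 \<le> T b" "T b \<le> n"
proof -
  have "T \<in> skew_diagram lam mu \<rightarrow>\<^sub>E {1..n}" using assms(1) by (simp add: ssyt_def)
  from PiE_mem[OF this assms(2)] show "1 \<le> T b" "T b \<le> n" by simp_all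
qed

text \<open>Rows increase weakly, so small entries come first; hence the cut, defined by counting,
  also marks the column where they stop.\<close>

lemma row_cut_segment:
  assumes T: "T \<in> ssyt n lam mu"
  shows "{j. (i, j) \<in> skew_diagram lam mu \<and> T (i, j) \<le> k} = {mu ! i<..row_cut lam mu T k i}"
  unfolding row_cut_def
proof (rule initial_segment[where l = "lam ! i"])
  show "{j. (i, j) \<in> skew_diagram lam mu \<and> T (i, j) \<le> k} \<subseteq> {mu ! i<..lam ! i}"
    by (auto simp: skew_diagram_def)
next
  fix h j
  assume j: "j \<in> {j. (i, j) \<in> skew_diagram lam mu \<and> T (i, j) \<le> k}" and h: "mu ! i < h" "h \<le> j"
  have box: "(i, h) \<in> skew_diagram lam mu" using j h by (auto simp: skew_diagram_def)
  have "T (i, h) \<le> T (i, j)"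
    using T j h box by (cases "h = j") (auto simp: ssyt_def)
  then show "h \<in> {j. (i, j) \<in> skew_diagram lam mu \<and> T (i, j) \<le> k}" using box j by simp
qed

lemma row_cut_iff:
  assumes "T \<in> ssyt n lam mu" and "(i, j) \<in> skew_diagram lam mu"
  shows "T (i, j) \<le> k \<longleftrightarrow> j \<le> row_cut lam mu T k i"
proof -
  have "T (i, j) \<le> k \<longleftrightarrow> j \<in> {mu ! i<..row_cut lam mu T k i}"
    using assms(2) unfolding row_cut_segment[OF assms(1), symmetric] by simp
  then show ?thesis using assms(2) by (simp add: skew_diagram_def)
qed

lemma row_cut_ge: "mu ! i \<le> row_cut lam mu T k i"
  by (simp add: row_cut_def)

lemma row_cut_box:
  assumes T: "T \<in> ssyt n lam mu" and "mu ! i < row_cut lam mu T k i"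
  shows "(i, row_cut lam mu T k i) \<in> skew_diagram lam mu" "T (i, row_cut lam mu T k i) \<le> k"
proof -
  have "row_cut lam mu T k i \<in> {mu ! i<..row_cut lam mu T k i}" using assms(2) by simp
  then have "row_cut lam mu T k i \<in> {j. (i, j) \<in> skew_diagram lam mu \<and> T (i, j) \<le> k}"
    by (simp only: row_cut_segment[OF T])
  then show "(i, row_cut lam mu T k i) \<in> skew_diagram lam mu" "T (i, row_cut lam mu T k i) \<le> k"
    by simp_all
qed

lemma row_cut_le:
  assumes "T \<in> ssyt n lam mu" and "mu ! i \<le> lam ! i"
  shows "row_cut lam mu T k i \<le> lam ! i"
proof (cases "mu ! i < row_cut lam mu T k i")
  case True
  from row_cut_box(1)[OF assms(1) this] show ?thesis by (simp add: skew_diagram_def)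
next
  case False
  then show ?thesis using assms(2) by simp
qed

lemma row_cut_mono:
  assumes "k \<le> k'"
  shows "row_cut lam mu T k i \<le> row_cut lam mu T k' i"
proof -
  have "finite {j. (i, j) \<in> skew_diagram lam mu \<and> T (i, j) \<le> k'}"
    by (rule finite_subset[of _ "{..lam ! i}"]) (auto simp: skew_diagram_def)
  then have "card {j. (i, j) \<in> skew_diagram lam mu \<and> T (i, j) \<le> k} \<le>
      card {j. (i, j) \<in> skew_diagram lam mu \<and> T (i, j) \<le> k'}"
    using assms by (intro card_mono) auto
  then show ?thesis by (simp add: row_cut_def)
qed

lemma row_cut_0:
  assumes "T \<in> ssyt n lam mu"
  shows "row_cut lam mu T 0 i = mu ! i"
proof -
  have "T b \<ge> 1" if "b \<in> skew_diagram lam mu" for b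
    using ssyt_entry[OF assms that] by simp
  then have "{j. (i, j) \<in> skew_diagram lam mu \<and> T (i, j) \<le> 0} = {}"
    by fastforce
  then show ?thesis by (simp only: row_cut_def card.empty add_0_right)
qed

lemma row_cut_max:
  assumes T: "T \<in> ssyt n lam mu" and "i < length lam" "mu ! i \<le> lam ! i"
  shows "row_cut lam mu T n i = lam ! i"
proof -
  have "T b \<le> n" if "b \<in> skew_diagram lam mu" for b
    using ssyt_entry[OF T that] by simp
  then have "{j. (i, j) \<in> skew_diagram lam mu \<and> T (i, j) \<le> n} = {mu ! i<..lam ! i}"
    using assms(2) by (auto simp: skew_diagram_def)
  then show ?thesis using assms(3) by (simp add: row_cut_def)
qed

text \<open>Column strictness: above a box with an entry at most \<open>k + 1\<close> stands a box
  with an entry at most \<open>k\<close>, or a box of \<open>mu\<close>.\<close>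

lemma row_cut_interlace:
  assumes T: "T \<in> ssyt n lam mu" and i: "Suc i < length lam"
    and mu: "mu ! Suc i \<le> mu ! i" and lam: "lam ! Suc i \<le> lam ! i"
  shows "row_cut lam mu T (Suc k) (Suc i) \<le> row_cut lam mu T k i"
proof (cases "mu ! i < row_cut lam mu T (Suc k) (Suc i)")
  case True
  let ?j = "row_cut lam mu T (Suc k) (Suc i)"
  have below: "(Suc i, ?j) \<in> skew_diagram lam mu" "T (Suc i, ?j) \<le> Suc k"
    using True mu by (auto intro!: row_cut_box[OF T])
  then have above: "(i, ?j) \<in> skew_diagram lam mu"
    using True lam i by (auto simp: skew_diagram_def)
  have "T (i, ?j) < T (Suc i, ?j)"
    using T above below unfolding ssyt_def by blast
  with below have "T (i, ?j) \<le> k" by simp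
  then show ?thesis using row_cut_iff[OF T above] by simp
next
  case False
  then show ?thesis using row_cut_ge[of mu i lam T k] by simp
qed

section \<open>From chains of partitions back to tableaux\<close>

definition tableau_of :: "nat list \<Rightarrow> nat list \<Rightarrow> nat list \<Rightarrow> nat list \<Rightarrow> nat \<times> nat \<Rightarrow> nat" where
  "tableau_of lam mu a b =
     (\<lambda>(i, j) \<in> skew_diagram lam mu. if j \<le> a ! i then 1 else if j \<le> b ! i then 2 else 3)"

text \<open>Says that \<open>u / v\<close> is a horizontal strip: no column contains two of its
  boxes.\<close>

definition interlacing :: "nat list \<Rightarrow> nat list \<Rightarrow> bool" where
  "interlacing u v \<longleftrightarrow> length u = 3 \<and> length v = 3 \<and> (\<forall>i<3. v ! i \<le> u ! i) \<and>
     (\<forall>i<2. u ! Suc i \<le> v ! i)"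

text \<open>Each entry fills a horizontal strip, so moving up a column inside the diagram leads to
  an earlier strip.\<close>

lemma tableau_of_ssyt:
  assumes "interlacing lam b" "interlacing b a" "interlacing a mu"
  shows "tableau_of lam mu a b \<in> ssyt 3 lam mu"
proof -
  let ?D = "skew_diagram lam mu" and ?T = "tableau_of lam mu a b"
  have le: "v ! i \<le> u ! i" if "interlacing u v" "i < 3" for u v i
    using that by (simp add: interlacing_def)
  \<comment> \<open>\<open>ssyt\<close> compares all pairs of rows, not only adjacent ones; rows 0
    and 2 are linked through row 1.\<close>
  have cross: "u ! i' \<le> v ! i" if "interlacing u v" "i < i'" "i' < 3" for u v i i'
  proof -
    have "i' = Suc i \<or> (i = 0 \<and> i' = 2)" using that by linarith
    then show ?thesis
    proof
      assume "i' = Suc i"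
      then show ?thesis using that by (simp add: interlacing_def)
    next
      assume "i = 0 \<and> i' = 2"
      moreover have "u ! 2 \<le> v ! 1" "v ! 1 \<le> u ! 1" "u ! 1 \<le> v ! 0"
        using that(1) unfolding interlacing_def by (auto simp: numeral_2_eq_2)
      ultimately show ?thesis by simp
    qed
  qed
  have len: "length lam = 3" using assms by (simp add: interlacing_def)
  have col: "?T (i, j) < ?T (i', j)" if "(i, j) \<in> ?D" "(i', j) \<in> ?D" "i < i'" for i i' j
  proof -
    have i': "i' < 3" using that by (simp add: skew_diagram_def len)
    have j: "mu ! i < j" "j \<le> lam ! i'" using that by (simp_all add: skew_diagram_def)
    show ?thesis
      using cross[OF assms(1) that(3) i'] cross[OF assms(2) that(3) i']
        cross[OF assms(3) that(3) i'] j that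
      by (auto simp: tableau_of_def)
  qed
  have row: "?T (i, j) \<le> ?T (i, j')" if "(i, j) \<in> ?D" "(i, j') \<in> ?D" "j < j'" for i j j'
    using that le[OF assms(2), of i] by (auto simp: tableau_of_def)
  have "?T \<in> ?D \<rightarrow>\<^sub>E {1..3}"
    by (auto simp: tableau_of_def restrict_def PiE_def extensional_def)
  then show ?thesis using col row unfolding ssyt_def by blast
qed

lemma row_cut_tableau_of:
  assumes "interlacing lam b" "interlacing b a" "interlacing a mu" and i: "i < 3"
  shows "row_cut lam mu (tableau_of lam mu a b) 1 i = a ! i"
    and "row_cut lam mu (tableau_of lam mu a b) 2 i = b ! i"
proof -
  have le: "mu ! i \<le> a ! i" "a ! i \<le> b ! i" "b ! i \<le> lam ! i" "length lam = 3"
    using assms by (simp_all add: interlacing_def)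
  have "{j. (i, j) \<in> skew_diagram lam mu \<and> tableau_of lam mu a b (i, j) \<le> 1} = {mu ! i<..a ! i}"
    using le i by (auto simp: tableau_of_def skew_diagram_def split: if_splits)
  then show "row_cut lam mu (tableau_of lam mu a b) 1 i = a ! i"
    using le by (simp add: row_cut_def)
  have "{j. (i, j) \<in> skew_diagram lam mu \<and> tableau_of lam mu a b (i, j) \<le> 2} = {mu ! i<..b ! i}"
    using le i by (auto simp: tableau_of_def skew_diagram_def split: if_splits)
  then show "row_cut lam mu (tableau_of lam mu a b) 2 i = b ! i"
    using le by (simp add: row_cut_def)
qed

text \<open>Entries lie in \<open>{1..3}\<close>, so the thresholds 1 and 2 determine each of them;
  off the diagram both sides are \<open>undefined\<close>.\<close>

lemma tableau_of_row_cut: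
  assumes T: "T \<in> ssyt 3 lam mu" and len: "length a = 3" "length b = 3" "length lam = 3"
    and "\<And>i. i < 3 \<Longrightarrow> a ! i = row_cut lam mu T 1 i"
    and "\<And>i. i < 3 \<Longrightarrow> b ! i = row_cut lam mu T 2 i"
  shows "tableau_of lam mu a b = T"
proof
  fix c :: "nat \<times> nat"
  obtain i j where c: "c = (i, j)" by (cases c)
  show "tableau_of lam mu a b c = T c"
  proof (cases "c \<in> skew_diagram lam mu")
    case True
    then have "i < 3" by (simp add: c skew_diagram_def len)
    moreover have "1 \<le> T c" "T c \<le> 3" using ssyt_entry[OF T True] by simp_all
    ultimately show ?thesis
      using True assms(5,6)[of i] row_cut_iff[OF T, of i j 1] row_cut_iff[OF T, of i j 2]
      by (auto simp: tableau_of_def c)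
  next
    case False
    moreover have "T c = undefined" using T False by (auto simp: ssyt_def intro: PiE_arb)
    ultimately show ?thesis by (simp add: tableau_of_def)
  qed
qed

lemma weight_tableau_of:
  assumes "interlacing lam b" "interlacing b a" "interlacing a mu"
  shows "weight 3 lam mu (tableau_of lam mu a b) =
     [\<Sum>i<3. a ! i - mu ! i, \<Sum>i<3. b ! i - a ! i, \<Sum>i<3. lam ! i - b ! i]"
proof -
  have le: "mu ! i \<le> a ! i" "a ! i \<le> b ! i" "b ! i \<le> lam ! i" if "i < 3" for i
    using assms that by (simp_all add: interlacing_def)
  have len: "length lam = 3" using assms by (simp add: interlacing_def)
  have card_sig: "card (SIGMA i:{..<3::nat}. {f i<..g i}) = (\<Sum>i<3. g i - f i)" for f g :: "nat \<Rightarrow> nat"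
    by simp
  let ?T = "tableau_of lam mu a b"
  have "{c \<in> skew_diagram lam mu. ?T c = 1} = (SIGMA i:{..<3}. {mu ! i<..a ! i})"
    using le by (fastforce simp: tableau_of_def skew_diagram_def len split: if_splits)
  moreover have "{c \<in> skew_diagram lam mu. ?T c = 2} = (SIGMA i:{..<3}. {a ! i<..b ! i})"
    using le by (fastforce simp: tableau_of_def skew_diagram_def len split: if_splits)
  moreover have "{c \<in> skew_diagram lam mu. ?T c = 3} = (SIGMA i:{..<3}. {b ! i<..lam ! i})"
    using le by (fastforce simp: tableau_of_def skew_diagram_def len split: if_splits)
  moreover have "[1..<Suc 3] = [1, 2, 3]" by (simp add: upt_rec)
  ultimately show ?thesis by (simp only: weight_def list.map card_sig)
qed

lemma interlacing_3:
  "interlacing [u0, u1, u2] [v0, v1, v2] \<longleftrightarrow>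
     v0 \<le> u0 \<and> v1 \<le> u1 \<and> v2 \<le> u2 \<and> u1 \<le> v0 \<and> u2 \<le> v1"
  by (auto simp: interlacing_def numeral_3_eq_3 numeral_2_eq_2 less_Suc_eq)

text \<open>Sending a tableau to its cuts at 1 and 2 is a bijection onto chains. Coordinates are
  listed row by row, so that the end points of each range depend only on earlier coordinates and the
  sum can be nested.\<close>

lemma skew_schur_chains:
  fixes x0 x1 x2 :: "'a::comm_semiring_1"
  assumes "l1 \<le> l0" "l2 \<le> l1" "m1 \<le> m0" "m2 \<le> m1" "m0 \<le> l0" "m1 \<le> l1" "m2 \<le> l2"
  shows "skew_schur [l0, l1, l2] [m0, m1, m2] [x0, x1, x2] =
    (\<Sum>(a0, b0, a1, b1, a2, b2) \<in> (SIGMA a0:{m0..l0}. SIGMA b0:{max a0 l1..l0}.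
        SIGMA a1:{m1..m0}. SIGMA b1:{max a1 l2..min l1 a0}. SIGMA a2:{m2..m1}. {a2..min l2 a1}).
      x0 ^ ((a0 + a1 + a2) - (m0 + m1 + m2)) * x1 ^ ((b0 + b1 + b2) - (a0 + a1 + a2)) *
      x2 ^ ((l0 + l1 + l2) - (b0 + b1 + b2)))"
    (is "_ = sum ?h ?C")
proof -
  let ?lam = "[l0, l1, l2]" and ?mu = "[m0, m1, m2]"
  let ?cut = "row_cut ?lam ?mu"
  let ?tab = "\<lambda>(a0, b0, a1, b1, a2, b2). tableau_of ?lam ?mu [a0, a1, a2] [b0, b1, b2]"
  let ?chain = "\<lambda>T. (?cut T 1 0, ?cut T 2 0, ?cut T 1 1, ?cut T 2 1, ?cut T 1 2, ?cut T 2 2)"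
  have chains: "interlacing ?lam [b0, b1, b2]" "interlacing [b0, b1, b2] [a0, a1, a2]"
      "interlacing [a0, a1, a2] ?mu" if "(a0, b0, a1, b1, a2, b2) \<in> ?C" for a0 b0 a1 b1 a2 b2
    using that assms by (auto simp: interlacing_3)
  have cut_mem: "?chain T \<in> ?C" if T: "T \<in> ssyt 3 ?lam ?mu" for T
  proof -
    have 1: "?cut T 1 i \<le> ?cut T 2 i" for i by (rule row_cut_mono) simp
    \<comment> \<open>Interlacing at \<open>k = 0\<close>, where the cut is \<open>mu\<close>;
      below, \<open>k = 2\<close> likewise brings in \<open>lam\<close> as the cut at 3.\<close>
    have 2: "?cut T 1 1 \<le> m0" "?cut T 1 2 \<le> m1"
      using row_cut_interlace[OF T, of 0 0] row_cut_interlace[OF T, of 1 0] assms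
      by (simp_all add: row_cut_0[OF T] numeral_2_eq_2)
    have 3: "?cut T 2 1 \<le> ?cut T 1 0" "?cut T 2 2 \<le> ?cut T 1 1"
      using row_cut_interlace[OF T, of 0 1] row_cut_interlace[OF T, of 1 1] assms
      by (simp_all add: numeral_2_eq_2)
    have 4: "l1 \<le> ?cut T 2 0" "l2 \<le> ?cut T 2 1"
      using row_cut_interlace[OF T, of 0 2] row_cut_interlace[OF T, of 1 2] assms
        row_cut_max[OF T, of 1] row_cut_max[OF T, of 2]
      by (simp_all add: numeral_2_eq_2 numeral_3_eq_3)
    have 5: "?cut T k 0 \<le> l0" "?cut T k 1 \<le> l1" "?cut T k 2 \<le> l2" for k
      using row_cut_le[OF T, of 0 k] row_cut_le[OF T, of 1 k] row_cut_le[OF T, of 2 k] assms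
      by simp_all
    have 6: "m0 \<le> ?cut T k 0" "m1 \<le> ?cut T k 1" "m2 \<le> ?cut T k 2" for k
      using row_cut_ge[of ?mu 0] row_cut_ge[of ?mu 1] row_cut_ge[of ?mu 2] by simp_all
    show ?thesis using 1 2 3 4 5 6 by auto
  qed
  have "skew_schur ?lam ?mu [x0, x1, x2] =
      (\<Sum>T\<in>ssyt 3 ?lam ?mu. monomial [x0, x1, x2] (weight 3 ?lam ?mu T))"
    by (simp add: skew_schur_def numeral_3_eq_3)
  also have "\<dots> = sum ?h ?C"
  proof (rule sum.reindex_bij_witness[where j = ?chain and i = ?tab])
    fix T assume T: "T \<in> ssyt 3 ?lam ?mu"
    show "?chain T \<in> ?C" by (rule cut_mem[OF T])
    show tab: "?tab (?chain T) = T"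
      unfolding prod.case
      by (rule tableau_of_row_cut[OF T]) (auto dest!: less_3_cases)
    obtain a0 b0 a1 b1 a2 b2 where c: "?chain T = (a0, b0, a1, b1, a2, b2)"
      by (rule that[OF refl])
    have mem: "(a0, b0, a1, b1, a2, b2) \<in> ?C" using cut_mem[OF T] unfolding c .
    have "T = tableau_of ?lam ?mu [a0, a1, a2] [b0, b1, b2]"
      using tab unfolding c prod.case by simp
    then have "weight 3 ?lam ?mu T = [(a0 - m0) + (a1 - m1) + (a2 - m2),
        (b0 - a0) + (b1 - a1) + (b2 - a2), (l0 - b0) + (l1 - b1) + (l2 - b2)]"
      using weight_tableau_of[OF chains[OF mem]] by (simp add: numeral_3_eq_3)
    also have "\<dots> = [(a0 + a1 + a2) - (m0 + m1 + m2), (b0 + b1 + b2) - (a0 + a1 + a2),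
        (l0 + l1 + l2) - (b0 + b1 + b2)]"
      using chains[OF mem] by (simp add: interlacing_3)
    finally show "?h (?chain T) = monomial [x0, x1, x2] (weight 3 ?lam ?mu T)"
      unfolding c by (simp add: monomial_def numeral_3_eq_3 mult_ac)
  next
    fix g assume g: "g \<in> ?C"
    obtain a0 b0 a1 b1 a2 b2 where c: "g = (a0, b0, a1, b1, a2, b2)" by (metis prod.exhaust)
    note ch = chains[OF g[unfolded c]]
    show "?tab g \<in> ssyt 3 ?lam ?mu"
      unfolding c prod.case by (rule tableau_of_ssyt[OF ch])
    show "?chain (?tab g) = g"
      unfolding c prod.case using row_cut_tableau_of[OF ch] by simp
  qed
  finally show ?thesis .
qed

section \<open>Sums of exponentials and their recursions\<close>

text \<open>Eventually finite sums of exponentials with bases in \<open>S\<close>. Eventual equality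
  is built in because the closed forms below hold only for large \<open>l\<close>; constant
  coefficients allow an annihilating polynomial with simple roots.\<close>

inductive_set exp_sums :: "'a::field set \<Rightarrow> (nat \<Rightarrow> 'a) set" for S :: "'a set" where
  zero: "(\<lambda>l. 0) \<in> exp_sums S"
| exponential: "y \<in> S \<Longrightarrow> (\<lambda>l. c * y ^ l) \<in> exp_sums S"
| add: "f \<in> exp_sums S \<Longrightarrow> g \<in> exp_sums S \<Longrightarrow> (\<lambda>l. f l + g l) \<in> exp_sums S"
| eventually_eq: "f \<in> exp_sums S \<Longrightarrow> \<forall>\<^sub>F l in sequentially. g l = f l \<Longrightarrow> g \<in> exp_sums S"

lemma exp_sums_mult_exponential:
  assumes "f \<in> exp_sums S" "\<And>s. s \<in> S \<Longrightarrow> s * y \<in> U"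
  shows "(\<lambda>l. f l * (c * y ^ l)) \<in> exp_sums U"
  using assms(1)
proof induction
  case zero
  then show ?case by (simp add: exp_sums.zero)
next
  case (exponential z d)
  have "(\<lambda>l. (d * c) * (z * y) ^ l) \<in> exp_sums U"
    using assms(2)[OF exponential] by (rule exp_sums.exponential)
  then show ?case by (simp add: power_mult_distrib mult_ac)
next
  case (add f g)
  then show ?case by (simp add: distrib_right exp_sums.add)
next
  case (eventually_eq f g)
  show ?case
    by (rule exp_sums.eventually_eq[OF eventually_eq(3)])
      (use eventually_eq(2) in eventually_elim, simp)
qed

lemma exp_sums_mult:
  assumes "f \<in> exp_sums S" "g \<in> exp_sums T" "\<And>s t. s \<in> S \<Longrightarrow> t \<in> T \<Longrightarrow> s * t \<in> U"
  shows "(\<lambda>l. f l * g l) \<in> exp_sums U"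
  using assms(2)
proof induction
  case zero
  then show ?case by (simp add: exp_sums.zero)
next
  case (exponential y c)
  then show ?case using assms(1,3) by (intro exp_sums_mult_exponential)
next
  case (add g h)
  then show ?case by (simp add: distrib_left exp_sums.add)
next
  case (eventually_eq g h)
  show ?case
    by (rule exp_sums.eventually_eq[OF eventually_eq(3)])
      (use eventually_eq(2) in eventually_elim, simp)
qed

lemma exp_sums_cmult:
  assumes "f \<in> exp_sums S"
  shows "(\<lambda>l. c * f l) \<in> exp_sums S"
  using exp_sums_mult_exponential[OF assms, of 1 S c] by (simp add: mult.commute)

lemma exp_sums_diff:
  assumes "f \<in> exp_sums S" "g \<in> exp_sums S"
  shows "(\<lambda>l. f l - g l) \<in> exp_sums S"
  using exp_sums.add[OF assms(1) exp_sums_cmult[OF assms(2), of "- 1"]] by simp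

lemma exp_sums_sum:
  assumes "\<And>i. i \<in> A \<Longrightarrow> f i \<in> exp_sums S"
  shows "(\<lambda>l. \<Sum>i\<in>A. f i l) \<in> exp_sums S"
proof (cases "finite A")
  case True
  then show ?thesis using assms by induction (simp_all add: exp_sums.zero exp_sums.add)
qed (simp add: exp_sums.zero)

text \<open>Collects the closure rules into one finite list and one threshold; a base may be listed
  several times.\<close>

lemma exp_sums_list:
  assumes "f \<in> exp_sums S"
  obtains xs where "snd ` set xs \<subseteq> S"
    and "\<forall>\<^sub>F l in sequentially. f l = (\<Sum>(c, y)\<leftarrow>xs. c * y ^ l)"
proof -
  from assms have "\<exists>xs. snd ` set xs \<subseteq> S \<and>
      (\<forall>\<^sub>F l in sequentially. f l = (\<Sum>(c, y)\<leftarrow>xs. c * y ^ l))"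
  proof induction
    case zero
    show ?case by (rule exI[of _ "[]"]) simp
  next
    case (exponential y c)
    then show ?case by (intro exI[of _ "[(c, y)]"]) simp
  next
    case (add f g)
    then obtain xs ys where xs: "snd ` set xs \<subseteq> S"
        "\<forall>\<^sub>F l in sequentially. f l = (\<Sum>(c, y)\<leftarrow>xs. c * y ^ l)"
      and ys: "snd ` set ys \<subseteq> S"
        "\<forall>\<^sub>F l in sequentially. g l = (\<Sum>(c, y)\<leftarrow>ys. c * y ^ l)"
      by blast
    have "\<forall>\<^sub>F l in sequentially. f l + g l = (\<Sum>(c, y)\<leftarrow>xs @ ys. c * y ^ l)"
      using xs(2) ys(2) by eventually_elim simp
    then show ?case using xs(1) ys(1) by (intro exI[of _ "xs @ ys"]) auto
  next
    case (eventually_eq f g)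
    then obtain xs where xs: "snd ` set xs \<subseteq> S"
        "\<forall>\<^sub>F l in sequentially. f l = (\<Sum>(c, y)\<leftarrow>xs. c * y ^ l)"
      by blast
    have "\<forall>\<^sub>F l in sequentially. g l = (\<Sum>(c, y)\<leftarrow>xs. c * y ^ l)"
      using xs(2) eventually_eq(2) by eventually_elim simp
    then show ?case using xs(1) by blast
  qed
  then show ?thesis using that by blast
qed

section \<open>Recursions and minimal polynomials of sums of exponentials\<close>

lemma recursion_poly_coeffs:
  fixes q :: "'a::field poly"
  assumes "lead_coeff q = 1"
  shows "recursion_poly (degree q) (\<lambda>j. - coeff q (degree q - j)) = q"
proof -
  let ?d = "degree q"
  have "(\<Sum>j=1..?d. monom (- coeff q (?d - j)) (?d - j)) = (\<Sum>i<?d. monom (- coeff q i) i)"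
    by (rule sum.reindex_bij_witness[of _ "\<lambda>i. ?d - i" "\<lambda>j. ?d - j"]) auto
  also have "\<dots> = - (\<Sum>i<?d. monom (coeff q i) i)"
    by (simp flip: minus_monom add: sum_negf)
  finally have "recursion_poly ?d (\<lambda>j. - coeff q (?d - j)) =
      monom (coeff q ?d) ?d + (\<Sum>i<?d. monom (coeff q i) i)"
    using assms by (simp add: recursion_poly_def)
  also have "\<dots> = (\<Sum>i\<le>?d. monom (coeff q i) i)"
    by (simp add: lessThan_Suc_atMost[symmetric] add.commute)
  finally show ?thesis by (simp add: poly_as_sum_of_monoms)
qed

text \<open>Putting \<open>n = l - degree q\<close> turns annihilation by \<open>q\<close> into the
  recursion; the constant term of \<open>q\<close> is, up to sign, its last coefficient.\<close>

lemma satisfies_recursion_coeffs: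
  fixes q :: "'a::field poly"
  assumes "lead_coeff q = 1" "degree q \<ge> 1" "coeff q 0 \<noteq> 0"
    and ann: "\<And>n. n \<ge> r \<Longrightarrow> (\<Sum>i\<le>degree q. coeff q i * a (n + i)) = 0"
  shows "satisfies_recursion a r (degree q) (\<lambda>j. - coeff q (degree q - j))"
  unfolding satisfies_recursion_def
proof (intro conjI allI impI)
  fix l assume l: "l \<ge> r + degree q"
  let ?d = "degree q"
  have "(\<Sum>j=1..?d. coeff q (?d - j) * a (l - j)) = (\<Sum>i<?d. coeff q i * a (l - ?d + i))"
    by (rule sum.reindex_bij_witness[of _ "\<lambda>i. ?d - i" "\<lambda>j. ?d - j"]) (use l in auto)
  moreover have "(\<Sum>i<?d. coeff q i * a (l - ?d + i)) + a l = 0"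
    using ann[of "l - ?d"] l assms(1) by (simp add: lessThan_Suc_atMost[symmetric])
  ultimately have "(\<Sum>j=1..?d. coeff q (?d - j) * a (l - j)) = - a l"
    by (simp add: eq_neg_iff_add_eq_0)
  then show "a l = (\<Sum>j=1..?d. - coeff q (?d - j) * a (l - j))"
    by (simp add: sum_negf)
qed (use assms in simp_all)

text \<open>The product of \<open>X - y\<close> over finitely many bases \<open>y\<close>
  annihilates the sequence past some index, so the minimal polynomial divides it.\<close>

lemma minimal_poly_roots:
  fixes f :: "nat \<Rightarrow> 'a::field"
  assumes f: "f \<in> exp_sums S" and S: "S \<noteq> {}" "0 \<notin> S"
  shows "\<forall>\<^sub>F r in sequentially. \<forall>p z. is_minimal_poly f r p \<longrightarrow> poly p z = 0 \<longrightarrow> z \<in> S"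
proof -
  obtain xs where xs: "snd ` set xs \<subseteq> S"
      "\<forall>\<^sub>F l in sequentially. f l = (\<Sum>(c, y)\<leftarrow>xs. c * y ^ l)"
    using exp_sums_list[OF f] .
  obtain y0 where y0: "y0 \<in> S" using S(1) by blast
  \<comment> \<open>The extra base \<open>y0\<close> keeps the degree of \<open>q\<close> positive
    when \<open>xs\<close> is empty, since recursions have order at least 1.\<close>
  define Y where "Y = insert y0 (snd ` set xs)"
  have Y: "finite Y" "Y \<noteq> {}" "Y \<subseteq> S" "snd ` set xs \<subseteq> Y"
    using xs(1) y0 by (auto simp: Y_def)
  define q where "q = (\<Prod>y\<in>Y. [:- y, 1:])"
  have poly_q: "poly q z = 0 \<longleftrightarrow> z \<in> Y" for z
    using Y(1) by (simp add: q_def poly_prod)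
  have lead: "lead_coeff q = 1" by (simp add: q_def lead_coeff_prod)
  have deg: "degree q \<ge> 1"
    using Y by (simp add: q_def degree_prod_sum_eq card_gt_0_iff Suc_le_eq)
  have coeff0: "coeff q 0 \<noteq> 0"
    using poly_q[of 0] S(2) Y(3) by (auto simp: poly_0_coeff_0)
  have ann: "(\<Sum>i\<le>degree q. coeff q i * (\<Sum>(c, y)\<leftarrow>zs. c * y ^ (n + i))) = 0"
    if "snd ` set zs \<subseteq> Y" for zs n
    using that
  proof (induction zs)
    case (Cons z zs)
    obtain c y where z: "z = (c, y)" by (cases z)
    have "(\<Sum>i\<le>degree q. coeff q i * (c * y ^ (n + i))) = c * y ^ n * poly q y"
      by (simp add: poly_altdef sum_distrib_left power_add mult_ac)
    also have "\<dots> = 0" using Cons.prems poly_q[of y] by (simp add: z)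
    finally show ?case using Cons by (simp add: z distrib_left sum.distrib)
  qed simp
  obtain N where N: "\<And>l. l \<ge> N \<Longrightarrow> f l = (\<Sum>(c, y)\<leftarrow>xs. c * y ^ l)"
    using xs(2) by (auto simp: eventually_sequentially)
  show ?thesis
    unfolding eventually_sequentially
  proof (intro exI[of _ N] allI impI)
    fix r p z assume r: "N \<le> r" and p: "is_minimal_poly f r p" "poly p z = 0"
    have "satisfies_recursion f r (degree q) (\<lambda>j. - coeff q (degree q - j))"
      by (rule satisfies_recursion_coeffs[OF lead deg coeff0])
        (use r ann[OF Y(4)] in \<open>simp add: N\<close>)
    then have "p dvd recursion_poly (degree q) (\<lambda>j. - coeff q (degree q - j))"
      using p(1) by (simp add: is_minimal_poly_def)
    then have "p dvd q" by (simp add: recursion_poly_coeffs[OF lead])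
    then have "poly q z = 0" using p(2) by (auto elim: dvdE)
    then show "z \<in> S" using poly_q Y(3) by blast
  qed
qed

section \<open>Geometric sums whose end points are linear in \<open>l\<close>\<close>

lemma geometric_interval:
  fixes u :: "'a::field"
  assumes "u \<noteq> 1" "m \<le> n"
  shows "(\<Sum>i=m..<n. u ^ i) = (u ^ n - u ^ m) / (u - 1)"
  using assms(2)
proof (induction n rule: dec_induct)
  case (step n)
  then show ?case using assms(1) by (simp add: field_simps)
qed simp

lemma geometric_interval_closed:
  fixes u :: "'a::field"
  assumes "u \<noteq> 1" "m \<le> Suc n"
  shows "(\<Sum>i=m..n. u ^ i) = (u ^ Suc n - u ^ m) / (u - 1)"
  using geometric_interval[OF assms] by (simp only: atLeastLessThanSuc_atLeastAtMost)

text \<open>The closed form consists of end-point terms, and \<open>u ^ (A + \<alpha> * l)\<close>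
  is a constant times \<open>(u ^ \<alpha>) ^ l\<close>. As \<alpha> < \<beta>, the end points are
  eventually in order and the closed form applies.\<close>

lemma exp_sums_geometric:
  fixes u :: "'a::field"
  assumes "u \<noteq> 1" "\<alpha> < \<beta>" "u ^ \<alpha> \<in> S" "u ^ \<beta> \<in> S"
  shows "(\<lambda>l. \<Sum>i=A + \<alpha> * l..<B + \<beta> * l. u ^ i) \<in> exp_sums S"
proof (rule exp_sums.eventually_eq)
  show "(\<lambda>l. u ^ B / (u - 1) * (u ^ \<beta>) ^ l - u ^ A / (u - 1) * (u ^ \<alpha>) ^ l) \<in> exp_sums S"
    using assms by (intro exp_sums_diff exp_sums.exponential)
  show "\<forall>\<^sub>F l in sequentially. (\<Sum>i=A + \<alpha> * l..<B + \<beta> * l. u ^ i) =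
      u ^ B / (u - 1) * (u ^ \<beta>) ^ l - u ^ A / (u - 1) * (u ^ \<alpha>) ^ l"
    using eventually_ge_at_top[of A]
  proof eventually_elim
    case (elim l)
    have "Suc \<alpha> * l \<le> \<beta> * l" using assms(2) by (intro mult_right_mono) simp_all
    then have "A + \<alpha> * l \<le> B + \<beta> * l" using elim by simp
    from geometric_interval[OF assms(1) this] show ?case
      by (simp add: power_add power_mult diff_divide_distrib)
  qed
qed

lemma exp_sums_geometric_closed:
  fixes u :: "'a::field"
  assumes "u \<noteq> 1" "\<alpha> < \<beta>" "u ^ \<alpha> \<in> S" "u ^ \<beta> \<in> S"
  shows "(\<lambda>l. \<Sum>i=A + \<alpha> * l..B + \<beta> * l. u ^ i) \<in> exp_sums S"
  using exp_sums_geometric[OF assms, of A "Suc B"]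
  by (simp add: atLeastLessThanSuc_atLeastAtMost)

section \<open>Asymptotics of the chain sums\<close>

text \<open>Only the exponent of \<open>p\<close> is restricted: \<open>q\<close> will be a ratio
  free of the first variable, whose degree decides the theorem.\<close>

definition monomials :: "'a::field \<Rightarrow> 'a \<Rightarrow> nat set \<Rightarrow> 'a set" where
  "monomials p q I = {p ^ i * q ^ j | i j. i \<in> I}"

lemma monomialsI: "i \<in> I \<Longrightarrow> z = p ^ i * q ^ j \<Longrightarrow> z \<in> monomials p q I"
  by (auto simp: monomials_def)

lemma exp_sums_monomials_mult:
  assumes "f \<in> exp_sums (monomials p q I)" "g \<in> exp_sums (monomials p q J)"
    and "\<And>i j. i \<in> I \<Longrightarrow> j \<in> J \<Longrightarrow> i + j \<in> K"
  shows "(\<lambda>l. f l * g l) \<in> exp_sums (monomials p q K)"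
proof (rule exp_sums_mult[OF assms(1,2)])
  fix s t assume "s \<in> monomials p q I" "t \<in> monomials p q J"
  then obtain i j i' j' where "i \<in> I" "i' \<in> J" "s = p ^ i * q ^ j" "t = p ^ i' * q ^ j'"
    by (auto simp: monomials_def)
  then show "s * t \<in> monomials p q K"
    using assms(3) by (intro monomialsI[of "i + i'" _ _ _ _ "j + j'"]) (simp_all add: power_add mult_ac)
qed

text \<open>The contribution of the two lower rows; \<open>e\<close> is the upper bound on \<open>b1\<close>, the only place where
  the top row enters.\<close>
definition lower_rows :: "'a::field \<Rightarrow> 'a \<Rightarrow> nat \<Rightarrow> nat \<Rightarrow> nat \<Rightarrow> nat \<Rightarrow> nat \<Rightarrow> 'a" where
  "lower_rows p q m0 m1 m2 l2 e =
     (\<Sum>a1=m1..m0. p ^ a1 * (\<Sum>b1=max a1 l2..e. q ^ b1) *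
        (\<Sum>a2=m2..m1. p ^ a2 * (\<Sum>b2=a2..min l2 a1. q ^ b2)))"

text \<open>Given \<open>a1\<close>, the ranges of \<open>b1\<close> and of \<open>(a2, b2)\<close>
  are independent, and \<open>a0\<close> reaches the lower rows only through
  \<open>min l1 a0\<close>.\<close>

lemma chain_sum_nested:
  fixes p q :: "'a::field"
  shows "(\<Sum>(a0, b0, a1, b1, a2, b2) \<in> (SIGMA a0:{m0..l0}. SIGMA b0:{max a0 l1..l0}.
        SIGMA a1:{m1..m0}. SIGMA b1:{max a1 l2..min l1 a0}. SIGMA a2:{m2..m1}. {a2..min l2 a1}).
      p ^ (a0 + a1 + a2) * q ^ (b0 + b1 + b2)) =
    (\<Sum>a0=m0..l0. p ^ a0 * (\<Sum>b0=max a0 l1..l0. q ^ b0) *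
       lower_rows p q m0 m1 m2 l2 (min l1 a0))"
    (is "?L = _")
proof -
  have "?L = (\<Sum>a0=m0..l0. \<Sum>b0=max a0 l1..l0. \<Sum>a1=m1..m0. \<Sum>b1=max a1 l2..min l1 a0.
      \<Sum>a2=m2..m1. \<Sum>b2=a2..min l2 a1.
        (p ^ a0 * q ^ b0) * (p ^ a1 * (q ^ b1 * (p ^ a2 * q ^ b2))))"
    by (simp add: sum.Sigma[symmetric] power_add mult_ac)
  also have "\<dots> = (\<Sum>a0=m0..l0. (p ^ a0 * (\<Sum>b0=max a0 l1..l0. q ^ b0)) *
      (\<Sum>a1=m1..m0. p ^ a1 * ((\<Sum>b1=max a1 l2..min l1 a0. q ^ b1) *
        (\<Sum>a2=m2..m1. p ^ a2 * (\<Sum>b2=a2..min l2 a1. q ^ b2)))))"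
    by (simp only: sum_distrib_left[symmetric] sum_distrib_right[symmetric])
  finally show ?thesis by (simp only: lower_rows_def mult.assoc)
qed

text \<open>The ratios of the geometric sums to come; \<open>p * q\<close> arises where a range of
  some \<open>b\<close> has an end point at some \<open>a\<close>.\<close>

locale ratios =
  fixes p q :: "'a::field"
  assumes p: "p \<noteq> 1" and q: "q \<noteq> 1" and pq: "p * q \<noteq> 1"
begin

lemma exp_sums_q:
  "\<alpha> < \<beta> \<Longrightarrow> (\<lambda>l. \<Sum>i=A + \<alpha> * l..B + \<beta> * l. q ^ i) \<in> exp_sums (monomials p q {0})"
  by (rule exp_sums_geometric_closed[OF q]) (auto intro: monomialsI[of 0])

lemma exp_sums_p:
  "\<alpha> < \<beta> \<Longrightarrow> (\<lambda>l. \<Sum>i=A + \<alpha> * l..<B + \<beta> * l. p ^ i) \<in> exp_sums (monomials p q {\<alpha>, \<beta>})"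
  by (rule exp_sums_geometric[OF p])
    (auto intro: monomialsI[of \<alpha> _ _ _ _ 0] monomialsI[of \<beta> _ _ _ _ 0])

lemma exp_sums_pq:
  "\<alpha> < \<beta> \<Longrightarrow> (\<lambda>l. \<Sum>i=A + \<alpha> * l..<B + \<beta> * l. (p * q) ^ i) \<in> exp_sums (monomials p q {\<alpha>, \<beta>})"
  by (rule exp_sums_geometric[OF pq])
    (auto intro: monomialsI[of \<alpha>] monomialsI[of \<beta>] simp: power_mult_distrib)

text \<open>The quotient is the closed form of the sum of \<open>q ^ j\<close> over
  \<open>i \<le> j < C + \<gamma> * l\<close>. Expanding it gives a sum in \<open>p\<close> times an
  exponential in \<open>q ^ \<gamma>\<close>, and a sum in \<open>p * q\<close>; both have only
  \<alpha> and \<beta> as exponents of \<open>p\<close>.\<close>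

lemma exp_sums_p_q_tail:
  assumes "\<alpha> < \<beta>"
  shows "(\<lambda>l. \<Sum>i=A + \<alpha> * l..<B + \<beta> * l. p ^ i * ((q ^ (C + \<gamma> * l) - q ^ i) / (q - 1)))
    \<in> exp_sums (monomials p q {\<alpha>, \<beta>})"
proof -
  have "(\<lambda>l. 1 / (q - 1) * ((\<Sum>i=A + \<alpha> * l..<B + \<beta> * l. p ^ i) * (q ^ C * (q ^ \<gamma>) ^ l) -
      (\<Sum>i=A + \<alpha> * l..<B + \<beta> * l. (p * q) ^ i))) \<in> exp_sums (monomials p q {\<alpha>, \<beta>})"
    by (intro exp_sums_cmult exp_sums_diff exp_sums_pq assms
        exp_sums_monomials_mult[OF exp_sums_p exp_sums.exponential[OF monomialsI[of 0 "{0}" _ _ _ \<gamma>]]])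
      simp_all
  moreover have "p ^ i * ((q ^ (C + \<gamma> * l) - q ^ i) / (q - 1)) =
      1 / (q - 1) * (p ^ i * (q ^ C * (q ^ \<gamma>) ^ l) - (p * q) ^ i)" for i l
    by (simp add: power_add power_mult power_mult_distrib right_diff_distrib diff_divide_distrib)
  ultimately show ?thesis
    by (simp only: sum_subtractf sum_distrib_left[symmetric] sum_distrib_right[symmetric])
qed

text \<open>The exponents 0, 1, 3 are the slopes in \<open>l\<close> of \<open>m1\<close>,
  \<open>B + l\<close> and \<open>min A e + 3 * l\<close>, where the effective range of
  \<open>a1\<close> begins, is split and ends.\<close>

lemma exp_sums_lower_rows:
  "(\<lambda>l. lower_rows p q (A + 3 * l) m1 m2 (B + l) (e + 3 * l)) \<in> exp_sums (monomials p q {0, 1, 3})"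
proof -
  let ?M = "monomials p q {0, 1, 3}"
  \<comment> \<open>Slopes 0 and 1 are written out as \<open>0 * l\<close> and \<open>1 * l\<close>
    to fit the general lemmas.\<close>
  define U where "U = (\<lambda>l. \<Sum>b1=B + 1 * l..e + 3 * l. q ^ b1)"
  define V where "V = (\<lambda>l. \<Sum>a2=m2..m1. p ^ a2 * (\<Sum>b2=a2 + 0 * l..B + 1 * l. q ^ b2))"
  \<comment> \<open>Summing \<open>q ^ b2\<close> over \<open>a2 \<le> b2 \<le> a1\<close>, then
    over \<open>a2\<close>, gives \<open>c * q ^ a1 - d\<close>; the range of \<open>a2\<close> does
    not grow with \<open>l\<close>, so \<open>c\<close> and \<open>d\<close> are constants.\<close>
  define c where "c = (\<Sum>a2=m2..m1. p ^ a2 * q / (q - 1))"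
  define d where "d = (\<Sum>a2=m2..m1. p ^ a2 * q ^ a2 / (q - 1))"
  define P where "P = (\<lambda>l. \<Sum>a1=m1 + 0 * l..<B + 1 * l. p ^ a1)"
  define Q where "Q = (\<lambda>l. \<Sum>a1=m1 + 0 * l..<B + 1 * l. (p * q) ^ a1)"
  define R where "R = (\<lambda>l. \<Sum>a1=B + 1 * l..<Suc (min A e) + 3 * l.
      p ^ a1 * ((q ^ (Suc e + 3 * l) - q ^ a1) / (q - 1)))"
  have U: "U \<in> exp_sums (monomials p q {0})"
    unfolding U_def by (rule exp_sums_q) simp
  have V: "V \<in> exp_sums (monomials p q {0})"
    unfolding V_def by (intro exp_sums_sum exp_sums_cmult exp_sums_q) simp
  have "(\<lambda>l. c * Q l - d * P l) \<in> exp_sums (monomials p q {0, 1})"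
    unfolding P_def Q_def by (intro exp_sums_diff exp_sums_cmult exp_sums_p exp_sums_pq) simp_all
  then have 1: "(\<lambda>l. U l * (c * Q l - d * P l)) \<in> exp_sums ?M"
    by (rule exp_sums_monomials_mult[OF U]) auto
  have "R \<in> exp_sums (monomials p q {1, 3})"
    unfolding R_def by (rule exp_sums_p_q_tail) simp_all
  then have 2: "(\<lambda>l. R l * V l) \<in> exp_sums ?M"
    using V by (rule exp_sums_monomials_mult) auto
  (* For a1 < B + l the range of b1 is fixed and that of b2 ends at a1; for a1 >= B + l it is the
     other way round. *)
  show ?thesis
  proof (rule exp_sums.eventually_eq[OF exp_sums.add[OF 1 2]])
    show "\<forall>\<^sub>F l in sequentially. lower_rows p q (A + 3 * l) m1 m2 (B + l) (e + 3 * l) =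
        U l * (c * Q l - d * P l) + R l * V l"
      \<comment> \<open>For these \<open>l\<close>, \<open>m1 \<le> B + l \<le> 3 * l\<close>, so
        the split point lies within the range of \<open>a1\<close>.\<close>
      using eventually_ge_at_top[of "m1 + B"]
    proof eventually_elim
      case (elim l)
      let ?g = "\<lambda>a1. p ^ a1 * (\<Sum>b1=max a1 (B + l)..e + 3 * l. q ^ b1) *
        (\<Sum>a2=m2..m1. p ^ a2 * (\<Sum>b2=a2..min (B + l) a1. q ^ b2))"
      have "lower_rows p q (A + 3 * l) m1 m2 (B + l) (e + 3 * l) = sum ?g {m1..<Suc (A + 3 * l)}"
        by (simp add: lower_rows_def atLeastLessThanSuc_atLeastAtMost)
      \<comment> \<open>For \<open>a1 > e + 3 * l\<close> the range of \<open>b1\<close> is empty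
        and the term vanishes.\<close>
      also have "\<dots> = sum ?g {m1..<Suc (min A e) + 3 * l}"
        using elim by (intro sum.mono_neutral_right) (auto simp: min_def not_less)
      also have "\<dots> = sum ?g {m1..<B + l} + sum ?g {B + l..<Suc (min A e) + 3 * l}"
        using elim by (intro sum.atLeastLessThan_concat[symmetric]) simp_all
      also have "sum ?g {m1..<B + l} = (\<Sum>a1=m1..<B + l. U l * (c * (p * q) ^ a1 - d * p ^ a1))"
      proof (rule sum.cong[OF refl])
        fix a1 assume a1: "a1 \<in> {m1..<B + l}"
        have "(\<Sum>a2=m2..m1. p ^ a2 * (\<Sum>b2=a2..min (B + l) a1. q ^ b2)) =
            (\<Sum>a2=m2..m1. p ^ a2 * ((q ^ Suc a1 - q ^ a2) / (q - 1)))"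
          using a1 by (intro sum.cong refl arg_cong2[of _ _ _ _ "(*)"])
            (simp add: min_def geometric_interval_closed[OF q])
        also have "\<dots> = c * q ^ a1 - d"
          by (simp add: c_def d_def sum_distrib_left sum_distrib_right sum_subtractf diff_divide_distrib
              right_diff_distrib mult_ac)
        finally have inner: "(\<Sum>a2=m2..m1. p ^ a2 * (\<Sum>b2=a2..min (B + l) a1. q ^ b2)) =
            c * q ^ a1 - d" .
        have "(\<Sum>b1=max a1 (B + l)..e + 3 * l. q ^ b1) = U l"
          using a1 by (simp add: U_def max_def)
        then show "?g a1 = U l * (c * (p * q) ^ a1 - d * p ^ a1)"
          unfolding inner by (simp add: power_mult_distrib algebra_simps)
      qed
      also have "\<dots> = U l * (c * Q l - d * P l)"
        by (simp add: P_def Q_def sum_subtractf flip: sum_distrib_left)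
      also have "sum ?g {B + l..<Suc (min A e) + 3 * l} = R l * V l"
        unfolding R_def V_def sum_distrib_right
      proof (intro sum.cong)
        fix a1 assume a1: "a1 \<in> {B + 1 * l..<Suc (min A e) + 3 * l}"
        then have "a1 \<le> Suc (e + 3 * l)" by auto
        with a1 show "?g a1 = p ^ a1 * ((q ^ (Suc e + 3 * l) - q ^ a1) / (q - 1)) *
            (\<Sum>a2=m2..m1. p ^ a2 * (\<Sum>b2=a2 + 0 * l..B + 1 * l. q ^ b2))"
          by (simp add: max_absorb1 min_absorb1 geometric_interval_closed[OF q])
      qed simp
      finally show ?case .
    qed
  qed
qed

lemma exp_sums_chains:
  "(\<lambda>l. \<Sum>a0=m0 + 3 * l..l0 + 5 * l. p ^ a0 * (\<Sum>b0=max a0 (l1 + 3 * l)..l0 + 5 * l. q ^ b0) *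
      lower_rows p q (m0 + 3 * l) m1 m2 (l2 + l) (min (l1 + 3 * l) a0))
    \<in> exp_sums (monomials p q {3, 4, 5, 6, 8})"
proof -
  let ?M = "monomials p q {3, 4, 5, 6, 8}"
  (* The columns shared by the two upper rows, a number independent of l (truncated to 0 if they
     are disjoint): the bound min (l1 + 3 l) a0 depends on a0 only for the first m values of a0. *)
  define m where "m = l1 - m0"
  define L where "L = (\<lambda>e l. lower_rows p q (m0 + 3 * l) m1 m2 (l2 + l) (e + 3 * l))"
  define U where "U = (\<lambda>l. \<Sum>b0=l1 + 3 * l..l0 + 5 * l. q ^ b0)"
  define R where "R = (\<lambda>l. \<Sum>a0=(m0 + m) + 3 * l..<Suc l0 + 5 * l.
      p ^ a0 * ((q ^ (Suc l0 + 5 * l) - q ^ a0) / (q - 1)))"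
  have L: "L e \<in> exp_sums (monomials p q {0, 1, 3})" for e
    unfolding L_def by (rule exp_sums_lower_rows)
  have U: "U \<in> exp_sums (monomials p q {0})"
    unfolding U_def by (rule exp_sums_q) simp
  \<comment> \<open>The first \<open>m\<close> values \<open>a0 = m0 + i + 3 * l\<close> share one
    range of \<open>b0\<close> and contribute the exponent 3 only.\<close>
  have "(\<lambda>l. p ^ (m0 + i) * (p ^ 3) ^ l * U l) \<in> exp_sums (monomials p q {3})" for i
    by (rule exp_sums_monomials_mult[OF exp_sums.exponential[OF monomialsI[of 3 "{3}" _ _ _ 0]] U])
      simp_all
  then have "(\<lambda>l. p ^ (m0 + i) * (p ^ 3) ^ l * U l * L (m0 + i) l) \<in> exp_sums ?M" for i
    by (rule exp_sums_monomials_mult[OF _ L]) auto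
  then have 1: "(\<lambda>l. \<Sum>i<m. p ^ (m0 + i) * (p ^ 3) ^ l * U l * L (m0 + i) l) \<in> exp_sums ?M"
    by (rule exp_sums_sum)
  have "R \<in> exp_sums (monomials p q {3, 5})"
    unfolding R_def by (rule exp_sums_p_q_tail) simp_all
  \<comment> \<open>Adding an element of \<open>{3, 5}\<close> to one of \<open>{0, 1, 3}\<close>
    gives 3, 4, 5, 6 or 8; the gap at 7 is what the theorem exploits.\<close>
  then have 2: "(\<lambda>l. R l * L l1 l) \<in> exp_sums ?M"
    by (rule exp_sums_monomials_mult[OF _ L]) auto
  show ?thesis
  proof (rule exp_sums.eventually_eq[OF exp_sums.add[OF 1 2]])
    show "\<forall>\<^sub>F l in sequentially.
        (\<Sum>a0=m0 + 3 * l..l0 + 5 * l. p ^ a0 * (\<Sum>b0=max a0 (l1 + 3 * l)..l0 + 5 * l. q ^ b0) *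
          lower_rows p q (m0 + 3 * l) m1 m2 (l2 + l) (min (l1 + 3 * l) a0)) =
        (\<Sum>i<m. p ^ (m0 + i) * (p ^ 3) ^ l * U l * L (m0 + i) l) + R l * L l1 l"
      using eventually_ge_at_top[of "m0 + l1"]
    proof eventually_elim
      case (elim l)
      let ?g = "\<lambda>a0. p ^ a0 * (\<Sum>b0=max a0 (l1 + 3 * l)..l0 + 5 * l. q ^ b0) *
          lower_rows p q (m0 + 3 * l) m1 m2 (l2 + l) (min (l1 + 3 * l) a0)"
      have "sum ?g {m0 + 3 * l..l0 + 5 * l} = sum ?g {m0 + 3 * l..<Suc l0 + 5 * l}"
        by (simp add: atLeastLessThanSuc_atLeastAtMost)
      also have "\<dots> = sum ?g {m0 + 3 * l..<m0 + m + 3 * l} + sum ?g {m0 + m + 3 * l..<Suc l0 + 5 * l}"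
        using elim by (intro sum.atLeastLessThan_concat[symmetric]) (simp_all add: m_def)
      also have "sum ?g {m0 + 3 * l..<m0 + m + 3 * l} =
          (\<Sum>i<m. p ^ (m0 + i) * (p ^ 3) ^ l * U l * L (m0 + i) l)"
      proof (rule sum.reindex_bij_witness[where i = "\<lambda>i. m0 + i + 3 * l" and j = "\<lambda>a0. a0 - (m0 + 3 * l)"])
        fix a0 assume "a0 \<in> {m0 + 3 * l..<m0 + m + 3 * l}"
        then obtain i where i: "a0 = m0 + i + 3 * l" "i < m"
          by (auto simp: le_iff_add)
        then show "p ^ (m0 + (a0 - (m0 + 3 * l))) * (p ^ 3) ^ l * U l *
            L (m0 + (a0 - (m0 + 3 * l))) l = ?g a0"
          by (simp add: m_def U_def L_def max_def min_def power_add power_mult)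
      qed auto
      also have "sum ?g {m0 + m + 3 * l..<Suc l0 + 5 * l} = R l * L l1 l"
        unfolding R_def sum_distrib_right
      proof (rule sum.cong[OF refl])
        fix a0 assume a0: "a0 \<in> {m0 + m + 3 * l..<Suc l0 + 5 * l}"
        then have "l1 + 3 * l \<le> a0" "a0 \<le> Suc (l0 + 5 * l)" by (auto simp: m_def)
        then show "?g a0 = p ^ a0 * ((q ^ (Suc l0 + 5 * l) - q ^ a0) / (q - 1)) * L l1 l"
          by (simp add: max_absorb1 min_absorb1 L_def geometric_interval_closed[OF q])
      qed
      finally show ?case .
    qed
  qed
qed

end

section \<open>The sequence of skew Schur polynomials\<close>

text \<open>The sizes of the outer and inner shapes grow by 9 and 3 with each step of
  \<open>l\<close>, whence the common factor \<open>x2 ^ 9 / x0 ^ 3\<close>. Distinctness of the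
  variables gives the three conditions of \<open>ratios\<close>.\<close>

lemma skew_schur_exp_sums:
  fixes x0 x1 x2 :: "'a::field"
  assumes x: "x0 \<noteq> 0" "x1 \<noteq> 0" "x2 \<noteq> 0" "x0 \<noteq> x1" "x1 \<noteq> x2" "x0 \<noteq> x2"
    and k: "k1 \<le> k0" "k2 \<le> k1" and n: "n1 \<le> n0" "n2 \<le> n1"
  shows "(\<lambda>l. skew_schur [k0 + 5 * l, k1 + 3 * l, k2 + l] [n0 + 3 * l, n1, n2] [x0, x1, x2])
    \<in> exp_sums ((\<lambda>z. x2 ^ 9 / x0 ^ 3 * z) ` monomials (x0 / x1) (x1 / x2) {3, 4, 5, 6, 8})"
proof -
  define p q where "p = x0 / x1" and "q = x1 / x2"
  interpret ratios p q
    by standard (use x in \<open>simp_all add: p_def q_def\<close>)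
  define H where "H = (\<lambda>l. \<Sum>a0=n0 + 3 * l..k0 + 5 * l.
      p ^ a0 * (\<Sum>b0=max a0 (k1 + 3 * l)..k0 + 5 * l. q ^ b0) *
      lower_rows p q (n0 + 3 * l) n1 n2 (k2 + l) (min (k1 + 3 * l) a0))"
  have "(\<lambda>l. H l * (x2 ^ (k0 + k1 + k2) / x0 ^ (n0 + n1 + n2) * (x2 ^ 9 / x0 ^ 3) ^ l))
      \<in> exp_sums ((\<lambda>z. x2 ^ 9 / x0 ^ 3 * z) ` monomials p q {3, 4, 5, 6, 8})"
    unfolding H_def
    by (rule exp_sums_mult_exponential[OF exp_sums_chains], subst mult.commute, rule imageI)
  then show ?thesis
    unfolding p_def[symmetric] q_def[symmetric]
  proof (rule exp_sums.eventually_eq)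
    show "\<forall>\<^sub>F l in sequentially.
        skew_schur [k0 + 5 * l, k1 + 3 * l, k2 + l] [n0 + 3 * l, n1, n2] [x0, x1, x2] =
        H l * (x2 ^ (k0 + k1 + k2) / x0 ^ (n0 + n1 + n2) * (x2 ^ 9 / x0 ^ 3) ^ l)"
      \<comment> \<open>The row lengths of the skew shape have slopes 2, 3 and 1, so for these
        \<open>l\<close> the outer shape contains the inner one.\<close>
      using eventually_ge_at_top[of "n0 + n1 + n2"]
    proof eventually_elim
      case (elim l)
      let ?l = "(k0 + 5 * l) + (k1 + 3 * l) + (k2 + l)" and ?m = "(n0 + 3 * l) + n1 + n2"
      let ?C = "SIGMA a0:{n0 + 3 * l..k0 + 5 * l}. SIGMA b0:{max a0 (k1 + 3 * l)..k0 + 5 * l}.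
        SIGMA a1:{n1..n0 + 3 * l}. SIGMA b1:{max a1 (k2 + l)..min (k1 + 3 * l) a0}.
        SIGMA a2:{n2..n1}. {a2..min (k2 + l) a1}"
      have chain_term: "x0 ^ (a - ?m) * x1 ^ (b - a) * x2 ^ (?l - b) = x2 ^ ?l / x0 ^ ?m * (p ^ a * q ^ b)"
        if "?m \<le> a" "a \<le> b" "b \<le> ?l" for a b
        using that x by (simp add: power_diff p_def q_def power_divide mult_ac)
      have "skew_schur [k0 + 5 * l, k1 + 3 * l, k2 + l] [n0 + 3 * l, n1, n2] [x0, x1, x2] =
          (\<Sum>(a0, b0, a1, b1, a2, b2) \<in> ?C. x0 ^ ((a0 + a1 + a2) - ?m) *
             x1 ^ ((b0 + b1 + b2) - (a0 + a1 + a2)) * x2 ^ (?l - (b0 + b1 + b2)))"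
        by (rule skew_schur_chains) (use k n elim in simp_all)
      also have "\<dots> = (\<Sum>(a0, b0, a1, b1, a2, b2) \<in> ?C.
          x2 ^ ?l / x0 ^ ?m * (p ^ (a0 + a1 + a2) * q ^ (b0 + b1 + b2)))"
      proof (rule sum.cong[OF refl], clarify)
        fix a0 b0 a1 b1 a2 b2
        assume "a0 \<in> {n0 + 3 * l..k0 + 5 * l}" "b0 \<in> {max a0 (k1 + 3 * l)..k0 + 5 * l}"
          "a1 \<in> {n1..n0 + 3 * l}" "b1 \<in> {max a1 (k2 + l)..min (k1 + 3 * l) a0}"
          "a2 \<in> {n2..n1}" "b2 \<in> {a2..min (k2 + l) a1}"
        then show "x0 ^ ((a0 + a1 + a2) - ?m) *
             x1 ^ ((b0 + b1 + b2) - (a0 + a1 + a2)) * x2 ^ (?l - (b0 + b1 + b2)) =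
             x2 ^ ?l / x0 ^ ?m * (p ^ (a0 + a1 + a2) * q ^ (b0 + b1 + b2))"
          by (intro chain_term add_mono) simp_all
      qed
      also have "\<dots> = x2 ^ ?l / x0 ^ ?m * H l"
        unfolding H_def chain_sum_nested[symmetric] by (simp add: sum_distrib_left case_prod_unfold)
      also have "x2 ^ ?l / x0 ^ ?m =
          x2 ^ (k0 + k1 + k2) / x0 ^ (n0 + n1 + n2) * (x2 ^ 9 / x0 ^ 3) ^ l"
      proof -
        have "?l = (k0 + k1 + k2) + 9 * l" "?m = (n0 + n1 + n2) + 3 * l" by simp_all
        then show ?thesis by (simp only: power_add power_mult power_divide times_divide_times_eq)
      qed
      finally show ?case by (simp only: mult.commute)
    qed
  qed
qed

section \<open>Finiteness of \<open>W\<close> and the weight (4, 2, 0)\<close>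

lemma finite_ssyt: "finite (ssyt n lam mu)"
proof -
  have "skew_diagram lam mu \<subseteq> (SIGMA i:{..<length lam}. {..lam ! i})"
    by (auto simp: skew_diagram_def)
  then have "finite (skew_diagram lam mu)" by (rule finite_subset) simp
  then have "finite (skew_diagram lam mu \<rightarrow>\<^sub>E {1..n})" by (intro finite_PiE) simp_all
  then show ?thesis by (rule finite_subset[rotated]) (auto simp: ssyt_def)
qed

text \<open>Makes \<open>W\<close> finite; a product over an infinite set would be 1 and have no
  root.\<close>

lemma finite_kostka_pos: "finite {w. length w = n \<and> kostka lam mu w > 0}"
proof (rule finite_subset)
  show "{w. length w = n \<and> kostka lam mu w > 0} \<subseteq> weight n lam mu ` ssyt n lam mu"
    by (force simp: kostka_def card_gt_0_iff)
qed (simp add: finite_ssyt)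

lemma kostka_weight_pos:
  assumes "T \<in> ssyt n lam mu"
  shows "kostka lam mu (weight n lam mu T) > 0"
proof -
  have len: "length (weight n lam mu T) = n" by (simp add: weight_def)
  have "finite {T' \<in> ssyt n lam mu. weight n lam mu T' = weight n lam mu T}"
    using finite_ssyt by simp
  then show ?thesis
    using assms by (auto simp: kostka_def len card_gt_0_iff)
qed

text \<open>The witness has rows 1 1, then 1 1 2, then 2; no entry is 3, so the second cut is
  already \<open>[5, 3, 1]\<close>.\<close>

lemma kostka_420: "kostka [5, 3, 1] [3, 0, 0] [4, 2, 0] > 0"
proof -
  have chain: "interlacing [5, 3, 1] [5, 3, 1]" "interlacing [5, 3, 1] [5, 2, 0]"
      "interlacing [5, 2, 0] [3, 0, 0]"
    by (simp_all add: interlacing_3)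
  have "weight 3 [5, 3, 1] [3, 0, 0] (tableau_of [5, 3, 1] [3, 0, 0] [5, 2, 0] [5, 3, 1]) =
      [4, 2, 0]"
    using weight_tableau_of[OF chain] by (simp add: numeral_3_eq_3)
  then show ?thesis
    using kostka_weight_pos[OF tableau_of_ssyt[OF chain]] by (simp only:)
qed

text \<open>The difference (2, 3, 1) rearranges to (3, 2, 1), whose partial sums 3, 5, 6 are
  compared with 4, 6, 6.\<close>

lemma dominates_420: "dominates (rearrange [4, 2, 0]) (rearrange (vsub [5, 3, 1] [3, 0, 0]))"
  by (auto simp: dominates_def rearrange_def vsub_def le_Suc_eq)

text \<open>The first variable lives in the innermost polynomial ring, hence the order of nesting.
  This form lets exponents be compared inside the fraction field.\<close>

lemma vars3_monomial:
  "monomial vars3 [a, b, c] = Fract (monom (monom (monom 1 a) b) c) 1"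
proof -
  have pow: "Fract x 1 ^ n = Fract (x ^ n) 1" for x :: "complex poly poly poly" and n
    by (induction n) (simp_all add: One_fract_def)
  have gens: "pCons 0 1 = monom (1 :: 'b) 1" "[:z:] = monom z 0"
    for z :: "'b::comm_semiring_1"
    by (simp_all add: monom_altdef one_pCons)
  show ?thesis
    by (simp add: monomial_def vars3_def numeral_3_eq_3 pow)
      (simp add: gens monom_power mult_monom)
qed

lemma vars3_monomial_eq_iff:
  "monomial vars3 [a, b, c] = monomial vars3 [a', b', c'] \<longleftrightarrow> a = a' \<and> b = b' \<and> c = c'"
  by (auto simp: vars3_monomial eq_fract monom_eq_iff')

theorem mainTheorem2:
  fixes lam mu kappa nu :: "nat list" and W :: "nat list set"
  assumes "lam = [5, 3, 1]" and "mu = [3, 0, 0]"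
    and "W = {w. length w = 3 \<and> kostka lam mu w > 0 \<and>
                 dominates (rearrange w) (rearrange (vsub lam mu))}"
    and "is_partition 3 kappa" and "is_partition 3 nu"
    and "\<exists>k\<ge>1. contains (vadd kappa (vscale k lam)) (vadd nu (vscale k mu))"
  shows "\<forall>\<^sub>F r in sequentially.
           \<not> is_minimal_poly
               (\<lambda>l. skew_schur (vadd kappa (vscale l lam)) (vadd nu (vscale l mu)) vars3) r
               (\<Prod>w\<in>W. [:- monomial vars3 w, 1:])"
proof -
  let ?s = "\<lambda>l. skew_schur (vadd kappa (vscale l lam)) (vadd nu (vscale l mu)) vars3"
  obtain k0 k1 k2 where kappa: "kappa = [k0, k1, k2]" and k: "k1 \<le> k0" "k2 \<le> k1"
    using assms(4) by (auto simp: is_partition_def numeral_3_eq_3 length_Suc_conv)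
  obtain n0 n1 n2 where nu: "nu = [n0, n1, n2]" and n: "n1 \<le> n0" "n2 \<le> n1"
    using assms(5) by (auto simp: is_partition_def numeral_3_eq_3 length_Suc_conv)
  obtain x0 x1 x2 where x: "vars3 = [x0, x1, x2]" by (simp add: vars3_def)
  have mono: "monomial vars3 [a, b, c] = x0 ^ a * x1 ^ b * x2 ^ c" for a b c
    by (simp add: x monomial_def numeral_3_eq_3 mult.assoc)
  note eq_iff = vars3_monomial_eq_iff[unfolded mono]
  \<comment> \<open>Each variable differs from its square, hence is nonzero.\<close>
  have ne: "x0 \<noteq> 0" "x1 \<noteq> 0" "x2 \<noteq> 0" "x0 \<noteq> x1" "x1 \<noteq> x2" "x0 \<noteq> x2"
    using eq_iff[of 1 0 0 2 0 0] eq_iff[of 0 1 0 0 2 0] eq_iff[of 0 0 1 0 0 2]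
      eq_iff[of 1 0 0 0 1 0] eq_iff[of 0 1 0 0 0 1] eq_iff[of 1 0 0 0 0 1]
    by auto
  let ?S = "(\<lambda>z. x2 ^ 9 / x0 ^ 3 * z) ` monomials (x0 / x1) (x1 / x2) {3, 4, 5, 6, 8}"
  have "?s = (\<lambda>l. skew_schur [k0 + 5 * l, k1 + 3 * l, k2 + l] [n0 + 3 * l, n1, n2] [x0, x1, x2])"
    by (simp add: assms(1,2) kappa nu x vadd_def vscale_def mult.commute)
  then have s: "?s \<in> exp_sums ?S"
    using skew_schur_exp_sums[OF ne k n] by simp
  have nonroot: "monomial vars3 [4, 2, 0] \<notin> ?S"
  proof
    assume "monomial vars3 [4, 2, 0] \<in> ?S"
    then obtain i j where i: "i \<in> {3, 4, 5, 6, 8}"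
      and eq: "x0 ^ 4 * x1 ^ 2 * x2 ^ 0 = x2 ^ 9 / x0 ^ 3 * ((x0 / x1) ^ i * (x1 / x2) ^ j)"
      unfolding mono monomials_def by blast
    \<comment> \<open>Denominators are cleared by \<open>x0 ^ 3 * x1 ^ i * x2 ^ j\<close>; comparing
      exponents of \<open>x0\<close> then forces \<open>i = 7\<close>.\<close>
    have "x0 ^ 7 * x1 ^ (2 + i) * x2 ^ j = x0 ^ 3 * x1 ^ i * x2 ^ j * (x0 ^ 4 * x1 ^ 2 * x2 ^ 0)"
      by (simp add: power_add eval_nat_numeral mult_ac)
    also have "\<dots> = x0 ^ i * x1 ^ j * x2 ^ 9"
      unfolding eq using ne by (simp add: power_divide)
    finally have "i = 7" unfolding eq_iff by simp
    with i show False by simp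
  qed
  have "?S \<noteq> {}" "0 \<notin> ?S" using ne by (auto simp: monomials_def)
  note roots = minimal_poly_roots[OF s this]
  have "[4, 2, 0] \<in> W" using kostka_420 dominates_420 by (simp add: assms(1-3))
  moreover have "finite W"
    using finite_kostka_pos[of 3 lam mu] by (rule finite_subset[rotated]) (auto simp: assms(3))
  ultimately have "poly (\<Prod>w\<in>W. [:- monomial vars3 w, 1:]) (monomial vars3 [4, 2, 0]) = 0"
    by (auto simp: poly_prod)
  with roots nonroot show ?thesis
    by (auto elim!: eventually_mono)
qed

end
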